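(* Let $\mathcal{A}$ be a quasi-abelian category, and let $$\begin{array}{ccccc} A & \xrightarrow{f} & B & \xrightarrow{g} & C\\ {\scriptstyle a}\downarrow & S & {\scriptstyle b}\downarrow & T & \downarrow{\scriptstyle c}\\ A' & \xrightarrow{f'} & B' & \xrightarrow{g'} & C'\end{array}$$ be a commutative diagram in $\mathcal{A}$ with exact rows (i.e. $\operatorname{im} f=\ker g$ and $\operatorname{im} f'=\ker g'$). If $b$ is strict, then the canonical morphism $\zeta:\operatorname{Ker}T\to\operatorname{Im}S$ is an isomorphism.
   Context: Composition is written right to left. For a morphism $\alpha$ in an additive category with kernels and cokernels, $\ker\alpha$, $\operatorname{coker}\alpha$ denote the kernel and cokernel morphisms and $\operatorname{Ker}\alpha$, $\operatorname{Coker}\alpha$ the corresponding objects; $\operatorname{im}\alpha=\ker\operatorname{coker}\alpha$ with source object $\operatorname{Im}\alpha$, $\operatorname{coim}\alpha=\operatorname{coker}\ker\alpha$ with target object $\operatorname{Coim}\alpha$; $\alpha=(\operatorname{im}\alpha)\bar\alpha(\operatorname{coim}\alpha)=(\operatorname{im}\alpha)\tilde\alpha$ is the canonical decomposition (so $\tilde\alpha=\bar\alpha\operatorname{coim}\alpha$). The morphism $\alpha$ is strict if $\bar\alpha$ is an isomorphism. A strict epimorphism is a morphism that is a cokernel; a strict monomorphism is a morphism that is a kernel. A quasi-abelian category is an additive category in which every morphism has a kernel and a cokernel, strict epimorphisms are stable under pullback, and strict monomorphisms are stable under pushout. A sequence $\cdot\xrightarrow{\alpha}\cdot\xrightarrow{\beta}\cdot$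 is exact if $\operatorname{im}\alpha=\ker\beta$ (as subobjects). Lambek invariants. For a commutative square $S$ with $\alpha:C\to D$, $g:C\to A$, $\beta:A\to B$, $f:D\to B$, $f\alpha=\beta g$ (letters here are local to this definition): (i) Let $I_S$ with $k_S:I_S\to\operatorname{Im}f$ and $l_S:I_S\to\operatorname{Im}\beta$ be the pullback of $\operatorname{im}f:\operatorname{Im}f\to B$ and $\operatorname{im}\beta:\operatorname{Im}\beta\to B$. There are morphisms $k':\operatorname{Im}(f\alpha)\to\operatorname{Im}f$ and $l':\operatorname{Im}(f\alpha)\to\operatorname{Im}\beta$ with $\operatorname{im}(f\alpha)=(\operatorname{im}f)k'=(\operatorname{im}\beta)l'$; let $\rho_S:\operatorname{Im}(f\alpha)\to I_S$ be the unique morphism with $k'=k_S\rho_S$, $l'=l_S\rho_S$. Put $\operatorname{Im}S=\operatorname{Coker}\rho_S$. (ii) Let $\mu_S:\operatorname{Ker}g\to\operatorname{Ker}(f\alpha)$ and $\nu_S:\operatorname{Ker}\alpha\to\operatorname{Ker}(f\alpha)$ be the natural inclusions, and $\langle\mu_S,\nu_S\rangle:\operatorname{Ker}g\oplus\operatorname{Ker}\alpha\to\operatorname{Ker}(f\alpha)$ the induced morphism. Put $\operatorname{Ker}S=\operatorname{Coker}\langle\mu_S,\nu_S\rangle$. In the diagram of the claim, $S$ is the square with top $f$, left $a$, bottom $f'$, right $b$, so $k_S:I_S\to\operatorname{Im}b$, $l_S:I_S\to\operatorname{Im}f'$ and $\rho_S:\operatorname{Im}(bf)\to I_S$; and $T$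 is the square with top $g$, left $b$, bottom $g'$, right $c$, so $\mu_T:\operatorname{Ker}b\to\operatorname{Ker}(g'b)$, $\nu_T:\operatorname{Ker}g\to\operatorname{Ker}(g'b)$ (note $cg=g'b$). The canonical morphism $\zeta$: when the rows are exact there is a unique morphism $\xi:\operatorname{Ker}(g'b)\to I_S$ with $k_S\xi=\tilde b\ker(g'b)$ and $(\operatorname{im}f')l_S\xi=b\ker(g'b)$, and $\zeta:\operatorname{Ker}T\to\operatorname{Im}S$ is the unique morphism with $(\operatorname{coker}\rho_S)\xi=\zeta\operatorname{coker}\langle\mu_T,\nu_T\rangle$ (both exist in any quasi-abelian category, without assuming $b$ strict). *)

theory Defs
  imports "HOL-Algebra.Group"
begin

section \<open>Additive categories\<close>

text \<open>
  A category with a partial addition on morphisms. Every morphism knows its domain and codomain,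
  so hom-sets are disjoint. Operations are meaningful only on elements of \<open>Ob\<close> and \<open>Ar\<close>;
  composition is written right to left.
\<close>

record ('o, 'm) catdata =
  Ob :: "'o set"
  Ar :: "'m set"
  Dom :: "'m \<Rightarrow> 'o"
  Cod :: "'m \<Rightarrow> 'o"
  Ident :: "'o \<Rightarrow> 'm"
  Comp :: "'m \<Rightarrow> 'm \<Rightarrow> 'm" (infixl \<open>\<cdot>\<index>\<close> 70)
  Plus :: "'m \<Rightarrow> 'm \<Rightarrow> 'm"
  Null :: "'o \<Rightarrow> 'o \<Rightarrow> 'm"

definition Hom :: "('o, 'm, 'e) catdata_scheme \<Rightarrow> 'o \<Rightarrow> 'o \<Rightarrow> 'm set" where
  "Hom C X Y = {f \<in> Ar C. Dom C f = X \<and> Cod C f = Y}"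

definition hom_group :: "('o, 'm, 'e) catdata_scheme \<Rightarrow> 'o \<Rightarrow> 'o \<Rightarrow> 'm monoid" where
  "hom_group C X Y = \<lparr>carrier = Hom C X Y, mult = Plus C, one = Null C X Y\<rparr>"

definition is_isomorphism :: "('o, 'm, 'e) catdata_scheme \<Rightarrow> 'm \<Rightarrow> bool" where
  "is_isomorphism C f \<longleftrightarrow> f \<in> Ar C \<and>
     (\<exists>g \<in> Hom C (Cod C f) (Dom C f).
        g \<cdot>\<^bsub>C\<^esub> f = Ident C (Dom C f) \<and> f \<cdot>\<^bsub>C\<^esub> g = Ident C (Cod C f))"

definition is_zero_object :: "('o, 'm, 'e) catdata_scheme \<Rightarrow> 'o \<Rightarrow> bool" where
  "is_zero_object C Z \<longleftrightarrow> Z \<in> Ob C \<and>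
     (\<forall>X \<in> Ob C. (\<exists>!f. f \<in> Hom C X Z) \<and> (\<exists>!f. f \<in> Hom C Z X))"

definition is_biproduct ::
  "('o, 'm, 'e) catdata_scheme \<Rightarrow> 'o \<Rightarrow> 'o \<Rightarrow> 'm \<Rightarrow> 'm \<Rightarrow> 'm \<Rightarrow> 'm \<Rightarrow> bool" where
  "is_biproduct C X Y i j p q \<longleftrightarrow>
     (\<exists>P \<in> Ob C. i \<in> Hom C X P \<and> j \<in> Hom C Y P \<and> p \<in> Hom C P X \<and> q \<in> Hom C P Y \<and>
        p \<cdot>\<^bsub>C\<^esub> i = Ident C X \<and> q \<cdot>\<^bsub>C\<^esub> j = Ident C Y \<and>
        p \<cdot>\<^bsub>C\<^esub> j = Null C Y X \<and> q \<cdot>\<^bsub>C\<^esub> i = Null C X Y \<and>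
        Plus C (i \<cdot>\<^bsub>C\<^esub> p) (j \<cdot>\<^bsub>C\<^esub> q) = Ident C P)"

locale category =
  fixes C (structure)
  assumes Dom_Ob: "f \<in> Ar C \<Longrightarrow> Dom C f \<in> Ob C"
    and Cod_Ob: "f \<in> Ar C \<Longrightarrow> Cod C f \<in> Ob C"
    and Ident_Hom: "X \<in> Ob C \<Longrightarrow> Ident C X \<in> Hom C X X"
    and Comp_Hom: "\<lbrakk>f \<in> Hom C X Y; g \<in> Hom C Y Z\<rbrakk> \<Longrightarrow> g \<cdot> f \<in> Hom C X Z"
    and Comp_Ident: "f \<in> Hom C X Y \<Longrightarrow> f \<cdot> Ident C X = f"
    and Ident_Comp: "f \<in> Hom C X Y \<Longrightarrow> Ident C Y \<cdot> f = f"
    and Comp_assoc: "\<lbrakk>f \<in> Hom C W X; g \<in> Hom C X Y; h \<in> Hom C Y Z\<rbrakk>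
                     \<Longrightarrow> (h \<cdot> g) \<cdot> f = h \<cdot> (g \<cdot> f)"

locale additive_category = category +
  assumes hom_comm_group: "\<lbrakk>X \<in> Ob C; Y \<in> Ob C\<rbrakk> \<Longrightarrow> comm_group (hom_group C X Y)"
    and Comp_Plus: "\<lbrakk>f \<in> Hom C X Y; f' \<in> Hom C X Y; g \<in> Hom C Y Z\<rbrakk>
                    \<Longrightarrow> g \<cdot> Plus C f f' = Plus C (g \<cdot> f) (g \<cdot> f')"
    and Plus_Comp: "\<lbrakk>f \<in> Hom C X Y; g \<in> Hom C Y Z; g' \<in> Hom C Y Z\<rbrakk>
                    \<Longrightarrow> Plus C g g' \<cdot> f = Plus C (g \<cdot> f) (g' \<cdot> f)"
    and zero_object: "\<exists>Z. is_zero_object C Z"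
    and biproducts: "\<lbrakk>X \<in> Ob C; Y \<in> Ob C\<rbrakk> \<Longrightarrow> \<exists>i j p q. is_biproduct C X Y i j p q"


section \<open>Quasi-abelian categories\<close>

definition is_kernel :: "('o, 'm, 'e) catdata_scheme \<Rightarrow> 'm \<Rightarrow> 'm \<Rightarrow> bool" where
  "is_kernel C k f \<longleftrightarrow> f \<in> Ar C \<and> k \<in> Ar C \<and> Cod C k = Dom C f \<and>
     f \<cdot>\<^bsub>C\<^esub> k = Null C (Dom C k) (Cod C f) \<and>
     (\<forall>h \<in> Ar C. Cod C h = Dom C f \<and> f \<cdot>\<^bsub>C\<^esub> h = Null C (Dom C h) (Cod C f) \<longrightarrow>
        (\<exists>!u. u \<in> Hom C (Dom C h) (Dom C k) \<and> k \<cdot>\<^bsub>C\<^esub> u = h))"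

definition is_cokernel :: "('o, 'm, 'e) catdata_scheme \<Rightarrow> 'm \<Rightarrow> 'm \<Rightarrow> bool" where
  "is_cokernel C q f \<longleftrightarrow> f \<in> Ar C \<and> q \<in> Ar C \<and> Dom C q = Cod C f \<and>
     q \<cdot>\<^bsub>C\<^esub> f = Null C (Dom C f) (Cod C q) \<and>
     (\<forall>h \<in> Ar C. Dom C h = Cod C f \<and> h \<cdot>\<^bsub>C\<^esub> f = Null C (Dom C f) (Cod C h) \<longrightarrow>
        (\<exists>!u. u \<in> Hom C (Cod C q) (Cod C h) \<and> u \<cdot>\<^bsub>C\<^esub> q = h))"

definition is_strict_mono :: "('o, 'm, 'e) catdata_scheme \<Rightarrow> 'm \<Rightarrow> bool" where
  "is_strict_mono C k \<longleftrightarrow> (\<exists>f. is_kernel C k f)"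

definition is_strict_epi :: "('o, 'm, 'e) catdata_scheme \<Rightarrow> 'm \<Rightarrow> bool" where
  "is_strict_epi C q \<longleftrightarrow> (\<exists>f. is_cokernel C q f)"

text \<open>In both definitions below the square in question is \<open>f p = g q\<close>, respectively \<open>p f = q g\<close>.\<close>

definition is_pullback :: "('o, 'm, 'e) catdata_scheme \<Rightarrow> 'm \<Rightarrow> 'm \<Rightarrow> 'm \<Rightarrow> 'm \<Rightarrow> bool" where
  "is_pullback C p q f g \<longleftrightarrow> f \<in> Ar C \<and> g \<in> Ar C \<and> p \<in> Ar C \<and> q \<in> Ar C \<and>
     Cod C f = Cod C g \<and> Dom C p = Dom C q \<and> Cod C p = Dom C f \<and> Cod C q = Dom C g \<and>
     f \<cdot>\<^bsub>C\<^esub> p = g \<cdot>\<^bsub>C\<^esub> q \<and>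
     (\<forall>x \<in> Ar C. \<forall>y \<in> Ar C.
        Dom C x = Dom C y \<and> Cod C x = Dom C f \<and> Cod C y = Dom C g \<and> f \<cdot>\<^bsub>C\<^esub> x = g \<cdot>\<^bsub>C\<^esub> y \<longrightarrow>
        (\<exists>!u. u \<in> Hom C (Dom C x) (Dom C p) \<and> p \<cdot>\<^bsub>C\<^esub> u = x \<and> q \<cdot>\<^bsub>C\<^esub> u = y))"

definition is_pushout :: "('o, 'm, 'e) catdata_scheme \<Rightarrow> 'm \<Rightarrow> 'm \<Rightarrow> 'm \<Rightarrow> 'm \<Rightarrow> bool" where
  "is_pushout C p q f g \<longleftrightarrow> f \<in> Ar C \<and> g \<in> Ar C \<and> p \<in> Ar C \<and> q \<in> Ar C \<and>
     Dom C f = Dom C g \<and> Cod C p = Cod C q \<and> Dom C p = Cod C f \<and> Dom C q = Cod C g \<and>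
     p \<cdot>\<^bsub>C\<^esub> f = q \<cdot>\<^bsub>C\<^esub> g \<and>
     (\<forall>x \<in> Ar C. \<forall>y \<in> Ar C.
        Cod C x = Cod C y \<and> Dom C x = Cod C f \<and> Dom C y = Cod C g \<and> x \<cdot>\<^bsub>C\<^esub> f = y \<cdot>\<^bsub>C\<^esub> g \<longrightarrow>
        (\<exists>!u. u \<in> Hom C (Cod C p) (Cod C x) \<and> u \<cdot>\<^bsub>C\<^esub> p = x \<and> u \<cdot>\<^bsub>C\<^esub> q = y))"

locale quasi_abelian_category = additive_category +
  assumes kernels: "f \<in> Ar C \<Longrightarrow> \<exists>k. is_kernel C k f"
    and cokernels: "f \<in> Ar C \<Longrightarrow> \<exists>q. is_cokernel C q f"
    and strict_epi_pullback:
      "\<lbrakk>is_pullback C p q f g; is_strict_epi C f\<rbrakk> \<Longrightarrow> is_strict_epi C q"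
    and strict_mono_pushout:
      "\<lbrakk>is_pushout C p q f g; is_strict_mono C f\<rbrakk> \<Longrightarrow> is_strict_mono C q"


section \<open>Kernels, images, strictness, exactness\<close>

text \<open>Universal constructions are unique only up to isomorphism; a choice is fixed by \<open>SOME\<close>.\<close>

definition ker :: "('o, 'm, 'e) catdata_scheme \<Rightarrow> 'm \<Rightarrow> 'm" where
  "ker C f = (SOME k. is_kernel C k f)"

definition coker :: "('o, 'm, 'e) catdata_scheme \<Rightarrow> 'm \<Rightarrow> 'm" where
  "coker C f = (SOME q. is_cokernel C q f)"

definition im :: "('o, 'm, 'e) catdata_scheme \<Rightarrow> 'm \<Rightarrow> 'm" where
  "im C f = ker C (coker C f)"

definition coim :: "('o, 'm, 'e) catdata_scheme \<Rightarrow> 'm \<Rightarrow> 'm" where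
  "coim C f = coker C (ker C f)"

definition Ker :: "('o, 'm, 'e) catdata_scheme \<Rightarrow> 'm \<Rightarrow> 'o" where
  "Ker C f = Dom C (ker C f)"

definition Coker :: "('o, 'm, 'e) catdata_scheme \<Rightarrow> 'm \<Rightarrow> 'o" where
  "Coker C f = Cod C (coker C f)"

definition Im :: "('o, 'm, 'e) catdata_scheme \<Rightarrow> 'm \<Rightarrow> 'o" where
  "Im C f = Dom C (im C f)"

definition Coim :: "('o, 'm, 'e) catdata_scheme \<Rightarrow> 'm \<Rightarrow> 'o" where
  "Coim C f = Cod C (coim C f)"

definition bar :: "('o, 'm, 'e) catdata_scheme \<Rightarrow> 'm \<Rightarrow> 'm" where
  "bar C f = (THE u. u \<in> Hom C (Coim C f) (Im C f) \<and> im C f \<cdot>\<^bsub>C\<^esub> (u \<cdot>\<^bsub>C\<^esub> coim C f) = f)"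

definition tilde :: "('o, 'm, 'e) catdata_scheme \<Rightarrow> 'm \<Rightarrow> 'm" where
  "tilde C f = bar C f \<cdot>\<^bsub>C\<^esub> coim C f"

definition is_strict :: "('o, 'm, 'e) catdata_scheme \<Rightarrow> 'm \<Rightarrow> bool" where
  "is_strict C f \<longleftrightarrow> is_isomorphism C (bar C f)"

definition same_subobject :: "('o, 'm, 'e) catdata_scheme \<Rightarrow> 'm \<Rightarrow> 'm \<Rightarrow> bool" where
  "same_subobject C m n \<longleftrightarrow>
     (\<exists>u \<in> Hom C (Dom C m) (Dom C n). is_isomorphism C u \<and> n \<cdot>\<^bsub>C\<^esub> u = m)"

definition is_exact :: "('o, 'm, 'e) catdata_scheme \<Rightarrow> 'm \<Rightarrow> 'm \<Rightarrow> bool" where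
  "is_exact C f g \<longleftrightarrow> f \<in> Ar C \<and> g \<in> Ar C \<and> Cod C f = Dom C g \<and>
     same_subobject C (im C f) (ker C g)"

text \<open>The factorization of \<open>h\<close> through a monomorphism \<open>m\<close>.\<close>

definition lift :: "('o, 'm, 'e) catdata_scheme \<Rightarrow> 'm \<Rightarrow> 'm \<Rightarrow> 'm" where
  "lift C m h = (THE u. u \<in> Hom C (Dom C h) (Dom C m) \<and> m \<cdot>\<^bsub>C\<^esub> u = h)"

definition direct_sum :: "('o, 'm, 'e) catdata_scheme \<Rightarrow> 'o \<Rightarrow> 'o \<Rightarrow> 'm \<times> 'm \<times> 'm \<times> 'm" where
  "direct_sum C X Y = (SOME (i, j, p, q). is_biproduct C X Y i j p q)"

definition copair :: "('o, 'm, 'e) catdata_scheme \<Rightarrow> 'm \<Rightarrow> 'm \<Rightarrow> 'm" where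
  "copair C u v = (case direct_sum C (Dom C u) (Dom C v) of (i, j, p, q) \<Rightarrow>
     (THE w. w \<in> Hom C (Cod C i) (Cod C u) \<and> w \<cdot>\<^bsub>C\<^esub> i = u \<and> w \<cdot>\<^bsub>C\<^esub> j = v))"


section \<open>Lambek invariants of a commutative square\<close>

record 'm square =
  sq_top :: 'm
  sq_left :: 'm
  sq_bottom :: 'm
  sq_right :: 'm

definition commutative_square :: "('o, 'm, 'e) catdata_scheme \<Rightarrow> 'm square \<Rightarrow> bool" where
  "commutative_square C S \<longleftrightarrow>
     sq_top S \<in> Ar C \<and> sq_left S \<in> Ar C \<and> sq_bottom S \<in> Ar C \<and> sq_right S \<in> Ar C \<and>
     Dom C (sq_top S) = Dom C (sq_left S) \<and> Cod C (sq_top S) = Dom C (sq_right S) \<and>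
     Cod C (sq_left S) = Dom C (sq_bottom S) \<and> Cod C (sq_right S) = Cod C (sq_bottom S) \<and>
     sq_right S \<cdot>\<^bsub>C\<^esub> sq_top S = sq_bottom S \<cdot>\<^bsub>C\<^esub> sq_left S"

definition diagonal :: "('o, 'm, 'e) catdata_scheme \<Rightarrow> 'm square \<Rightarrow> 'm" where
  "diagonal C S = sq_right S \<cdot>\<^bsub>C\<^esub> sq_top S"

definition im_pullback :: "('o, 'm, 'e) catdata_scheme \<Rightarrow> 'm square \<Rightarrow> 'm \<times> 'm" where
  "im_pullback C S = (SOME (k, l). is_pullback C k l (im C (sq_right S)) (im C (sq_bottom S)))"

definition sq_k :: "('o, 'm, 'e) catdata_scheme \<Rightarrow> 'm square \<Rightarrow> 'm" where
  "sq_k C S = fst (im_pullback C S)"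

definition sq_l :: "('o, 'm, 'e) catdata_scheme \<Rightarrow> 'm square \<Rightarrow> 'm" where
  "sq_l C S = snd (im_pullback C S)"

definition sq_I :: "('o, 'm, 'e) catdata_scheme \<Rightarrow> 'm square \<Rightarrow> 'o" where
  "sq_I C S = Dom C (sq_k C S)"

definition sq_rho :: "('o, 'm, 'e) catdata_scheme \<Rightarrow> 'm square \<Rightarrow> 'm" where
  "sq_rho C S = (THE r. r \<in> Hom C (Im C (diagonal C S)) (sq_I C S) \<and>
     sq_k C S \<cdot>\<^bsub>C\<^esub> r = lift C (im C (sq_right S)) (im C (diagonal C S)) \<and>
     sq_l C S \<cdot>\<^bsub>C\<^esub> r = lift C (im C (sq_bottom S)) (im C (diagonal C S)))"

definition sq_Im :: "('o, 'm, 'e) catdata_scheme \<Rightarrow> 'm square \<Rightarrow> 'o" where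
  "sq_Im C S = Coker C (sq_rho C S)"

definition sq_mu :: "('o, 'm, 'e) catdata_scheme \<Rightarrow> 'm square \<Rightarrow> 'm" where
  "sq_mu C S = lift C (ker C (diagonal C S)) (ker C (sq_left S))"

definition sq_nu :: "('o, 'm, 'e) catdata_scheme \<Rightarrow> 'm square \<Rightarrow> 'm" where
  "sq_nu C S = lift C (ker C (diagonal C S)) (ker C (sq_top S))"

definition sq_Ker :: "('o, 'm, 'e) catdata_scheme \<Rightarrow> 'm square \<Rightarrow> 'o" where
  "sq_Ker C S = Coker C (copair C (sq_mu C S) (sq_nu C S))"


section \<open>The canonical morphism for two adjacent squares\<close>

text \<open>
  Here \<open>S\<close> stands to the left of \<open>T\<close>, so \<open>sq_right S = sq_left T\<close> is the middle vertical morphism.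
\<close>

definition xi :: "('o, 'm, 'e) catdata_scheme \<Rightarrow> 'm square \<Rightarrow> 'm square \<Rightarrow> 'm" where
  "xi C S T =
     (let b = sq_left T; k = ker C (sq_bottom T \<cdot>\<^bsub>C\<^esub> b)
      in THE x. x \<in> Hom C (Dom C k) (sq_I C S) \<and>
           sq_k C S \<cdot>\<^bsub>C\<^esub> x = tilde C b \<cdot>\<^bsub>C\<^esub> k \<and>
           im C (sq_bottom S) \<cdot>\<^bsub>C\<^esub> (sq_l C S \<cdot>\<^bsub>C\<^esub> x) = b \<cdot>\<^bsub>C\<^esub> k)"

definition zeta :: "('o, 'm, 'e) catdata_scheme \<Rightarrow> 'm square \<Rightarrow> 'm square \<Rightarrow> 'm" where
  "zeta C S T = (THE z. z \<in> Hom C (sq_Ker C T) (sq_Im C S) \<and>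
     coker C (sq_rho C S) \<cdot>\<^bsub>C\<^esub> xi C S T = z \<cdot>\<^bsub>C\<^esub> coker C (copair C (sq_mu C T) (sq_nu C T)))"

end

theory Submission
  imports Defs
begin

text \<open>
  Write \<open>\<kappa> = ker (g' b)\<close>. Since \<open>im f' = ker g'\<close>, a pair of morphisms \<open>x\<close> into \<open>B\<close> and \<open>y\<close> into
  \<open>I\<^sub>S\<close> with \<open>tilde b x = k\<^sub>S y\<close> has \<open>b x\<close> factoring through \<open>im f'\<close>, so \<open>x\<close> factors through \<open>\<kappa>\<close>. Hence
  the square \<open>k\<^sub>S \<xi> = tilde b \<kappa>\<close> is a pullback (\<open>xi_pullback\<close>). Strictness of \<open>b\<close> enters at one place
  only: it makes \<open>tilde b\<close> a cokernel of \<open>ker b\<close>, and therefore \<open>\<xi>\<close> is a strict epimorphism, as a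
  pullback of \<open>tilde b\<close>.

  It follows that \<open>coker \<rho>\<^sub>S \<cdot> \<xi>\<close> is itself a cokernel of \<open>\<langle>\<mu>\<^sub>T, \<nu>\<^sub>T\<rangle>\<close> (\<open>coker_rho_xi_is_cokernel\<close>). The
  morphisms \<open>h\<close> with \<open>h \<mu>\<^sub>T = 0\<close> are those that factor through \<open>\<xi>\<close>, because \<open>\<xi> u = 0\<close> forces \<open>u\<close> to factor
  through \<open>\<mu>\<^sub>T\<close>. For \<open>h = h' \<xi>\<close>, the condition \<open>h \<nu>\<^sub>T = 0\<close> amounts to \<open>h' \<rho>\<^sub>S = 0\<close> (\<open>xi_nu_zero_iff\<close>): up to
  the isomorphism of \<open>Ker g\<close> and \<open>Im f\<close>, both \<open>\<xi> \<nu>\<^sub>T tilde f\<close> and \<open>\<rho>\<^sub>S tilde (b f)\<close> are the factorization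
  of \<open>b f\<close> through \<open>I\<^sub>S\<close>, and the two tildes can be cancelled. So \<open>\<zeta>\<close> compares two cokernels of the same
  morphism.

  That tildes can be cancelled (\<open>tilde_zero_cancel\<close>) is the one use of the pushout axiom: pushing
  \<open>im f\<close> out along \<open>coker (tilde f)\<close> gives the zero morphism, which must be a monomorphism.
\<close>

section \<open>Zero morphisms, kernels and cokernels\<close>

context additive_category
begin

lemma Hom_objects: "f \<in> Hom C X Y \<Longrightarrow> X \<in> Ob C \<and> Y \<in> Ob C"
  using Dom_Ob Cod_Ob by (auto simp: Hom_def)

lemma Null_Hom: "\<lbrakk>X \<in> Ob C; Y \<in> Ob C\<rbrakk> \<Longrightarrow> Null C X Y \<in> Hom C X Y"
  using monoid.one_closed[of "hom_group C X Y"] hom_comm_group[of X Y]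
  by (auto simp: hom_group_def comm_group_def group_def)

lemma Null_Plus_Null: "\<lbrakk>X \<in> Ob C; Y \<in> Ob C\<rbrakk> \<Longrightarrow> Plus C (Null C X Y) (Null C X Y) = Null C X Y"
  using monoid.l_one[of "hom_group C X Y" "Null C X Y"] hom_comm_group[of X Y] Null_Hom[of X Y]
  by (auto simp: hom_group_def comm_group_def group_def)

lemma Plus_idem_imp_Null:
  assumes "f \<in> Hom C X Y" "Plus C f f = f"
  shows "f = Null C X Y"
proof -
  interpret G: comm_group "hom_group C X Y"
    using hom_comm_group Hom_objects[OF assms(1)] by blast
  show ?thesis
    using assms G.l_cancel_one[of f f] by (simp add: hom_group_def)
qed

lemma Comp_Null:
  assumes f: "f \<in> Hom C X Y" and W: "W \<in> Ob C"
  shows "f \<cdot> Null C W X = Null C W Y"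
proof -
  have n: "Null C W X \<in> Hom C W X" and i: "X \<in> Ob C"
    using Null_Hom Hom_objects[OF f] W by auto
  have "Plus C (f \<cdot> Null C W X) (f \<cdot> Null C W X) = f \<cdot> Null C W X"
    using Comp_Plus[OF n n f] Null_Plus_Null[OF W i] by simp
  then show ?thesis
    using Plus_idem_imp_Null Comp_Hom[OF n f] by blast
qed

lemma Null_Comp:
  assumes f: "f \<in> Hom C X Y" and Z: "Z \<in> Ob C"
  shows "Null C Y Z \<cdot> f = Null C X Z"
proof -
  have n: "Null C Y Z \<in> Hom C Y Z" and i: "Y \<in> Ob C"
    using Null_Hom Hom_objects[OF f] Z by auto
  have "Plus C (Null C Y Z \<cdot> f) (Null C Y Z \<cdot> f) = Null C Y Z \<cdot> f"
    using Plus_Comp[OF f n n] Null_Plus_Null[OF i Z] by simp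
  then show ?thesis
    using Plus_idem_imp_Null Comp_Hom[OF f n] by blast
qed

text \<open>
  The universal properties are restated with explicit hom-sets in place of \<open>Dom\<close> and \<open>Cod\<close>, so that
  typing facts of the form \<open>f \<in> Hom C X Y\<close> apply directly.
\<close>

lemma is_kernel_iff:
  assumes "f \<in> Hom C Y Z" "k \<in> Hom C K Y"
  shows "is_kernel C k f \<longleftrightarrow> f \<cdot> k = Null C K Z \<and>
    (\<forall>h X. h \<in> Hom C X Y \<and> f \<cdot> h = Null C X Z \<longrightarrow> (\<exists>!u. u \<in> Hom C X K \<and> k \<cdot> u = h))"
  using assms by (simp add: is_kernel_def Hom_def Ball_def imp_conjL conj_ac cong: conj_cong)

lemma is_cokernel_iff:
  assumes "f \<in> Hom C X Y" "q \<in> Hom C Y Q"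
  shows "is_cokernel C q f \<longleftrightarrow> q \<cdot> f = Null C X Q \<and>
    (\<forall>h Z. h \<in> Hom C Y Z \<and> h \<cdot> f = Null C X Z \<longrightarrow> (\<exists>!u. u \<in> Hom C Q Z \<and> u \<cdot> q = h))"
  using assms by (simp add: is_cokernel_def Hom_def Ball_def imp_conjL conj_ac cong: conj_cong)

lemma is_kernelD:
  assumes "is_kernel C k f"
  shows "f \<in> Hom C (Dom C f) (Cod C f)" "k \<in> Hom C (Dom C k) (Dom C f)"
    "f \<cdot> k = Null C (Dom C k) (Cod C f)"
  using assms by (simp_all add: is_kernel_def Hom_def)

lemma is_cokernelD:
  assumes "is_cokernel C q f"
  shows "f \<in> Hom C (Dom C f) (Cod C f)" "q \<in> Hom C (Cod C f) (Cod C q)"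
    "q \<cdot> f = Null C (Dom C f) (Cod C q)"
  using assms by (simp_all add: is_cokernel_def Hom_def)

lemma is_pullbackD:
  assumes "is_pullback C p q f g"
  shows "p \<in> Hom C (Dom C p) (Dom C f)" "q \<in> Hom C (Dom C p) (Dom C g)" "f \<cdot> p = g \<cdot> q"
  using assms unfolding is_pullback_def Hom_def by (elim conjE, simp)+

lemma is_pullback_iff:
  assumes "f \<in> Hom C X Z" "g \<in> Hom C Y Z" "p \<in> Hom C P X" "q \<in> Hom C P Y"
  shows "is_pullback C p q f g \<longleftrightarrow> f \<cdot> p = g \<cdot> q \<and>
    (\<forall>x y W. y \<in> Hom C W Y \<and> x \<in> Hom C W X \<and> f \<cdot> x = g \<cdot> y \<longrightarrow>
       (\<exists>!u. u \<in> Hom C W P \<and> p \<cdot> u = x \<and> q \<cdot> u = y))"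
  using assms by (simp add: is_pullback_def Hom_def Ball_def imp_conjL conj_ac
      eq_commute[of "Dom C x" "Dom C y" for x y] cong: conj_cong) blast

lemma is_pushout_iff:
  assumes "f \<in> Hom C Z X" "g \<in> Hom C Z Y" "p \<in> Hom C X P" "q \<in> Hom C Y P"
  shows "is_pushout C p q f g \<longleftrightarrow> p \<cdot> f = q \<cdot> g \<and>
    (\<forall>x y W. y \<in> Hom C Y W \<and> x \<in> Hom C X W \<and> x \<cdot> f = y \<cdot> g \<longrightarrow>
       (\<exists>!u. u \<in> Hom C P W \<and> u \<cdot> p = x \<and> u \<cdot> q = y))"
  using assms by (simp add: is_pushout_def Hom_def Ball_def imp_conjL conj_ac
      eq_commute[of "Cod C x" "Cod C y" for x y] cong: conj_cong) blast

lemma is_isomorphism_iff: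
  assumes "f \<in> Hom C X Y"
  shows "is_isomorphism C f \<longleftrightarrow> (\<exists>g \<in> Hom C Y X. g \<cdot> f = Ident C X \<and> f \<cdot> g = Ident C Y)"
  using assms by (auto simp: is_isomorphism_def Hom_def)

lemma is_kernel_cancel:
  assumes "is_kernel C k f" "u \<in> Hom C W (Dom C k)" "v \<in> Hom C W (Dom C k)" "k \<cdot> u = k \<cdot> v"
  shows "u = v"
proof -
  have k: "k \<in> Hom C (Dom C k) (Dom C f)" and f: "f \<in> Hom C (Dom C f) (Cod C f)"
    using is_kernelD[OF assms(1)] by blast+
  have "f \<cdot> (k \<cdot> u) = Null C W (Cod C f)"
    using Comp_assoc[OF assms(2) k f] Null_Comp[OF assms(2)] Hom_objects[OF f] is_kernelD(3)[OF assms(1)]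
    by simp
  then have "\<exists>!w. w \<in> Hom C W (Dom C k) \<and> k \<cdot> w = k \<cdot> u"
    using is_kernel_iff[OF f k] assms(1) Comp_Hom[OF assms(2) k] by blast
  then show ?thesis
    using assms by auto
qed

lemma is_cokernel_cancel:
  assumes "is_cokernel C q f" "u \<in> Hom C (Cod C q) W" "v \<in> Hom C (Cod C q) W" "u \<cdot> q = v \<cdot> q"
  shows "u = v"
proof -
  have q: "q \<in> Hom C (Cod C f) (Cod C q)" and f: "f \<in> Hom C (Dom C f) (Cod C f)"
    using is_cokernelD[OF assms(1)] by blast+
  have "(u \<cdot> q) \<cdot> f = Null C (Dom C f) W"
    using Comp_assoc[OF f q assms(2)] Comp_Null[OF assms(2)] Hom_objects[OF f] is_cokernelD(3)[OF assms(1)]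
    by simp
  then have "\<exists>!w. w \<in> Hom C (Cod C q) W \<and> w \<cdot> q = u \<cdot> q"
    using is_cokernel_iff[OF f q] assms(1) Comp_Hom[OF q assms(2)] by blast
  then show ?thesis
    using assms by auto
qed

lemma is_cokernel_unique_up_to_iso:
  assumes q: "is_cokernel C q f" and r: "is_cokernel C r f"
    and u: "u \<in> Hom C (Cod C q) (Cod C r)" "u \<cdot> q = r"
  shows "is_isomorphism C u"
proof -
  have f: "f \<in> Hom C (Dom C f) (Cod C f)" and qH: "q \<in> Hom C (Cod C f) (Cod C q)"
    and rH: "r \<in> Hom C (Cod C f) (Cod C r)"
    using is_cokernelD[OF q] is_cokernelD[OF r] by auto
  obtain v where v: "v \<in> Hom C (Cod C r) (Cod C q)" "v \<cdot> r = q"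
    using r q is_cokernel_iff[OF f rH] is_cokernel_iff[OF f qH] qH by blast
  have id: "Ident C (Cod C q) \<in> Hom C (Cod C q) (Cod C q)"
    "Ident C (Cod C r) \<in> Hom C (Cod C r) (Cod C r)"
    using Ident_Hom Hom_objects[OF qH] Hom_objects[OF rH] by auto
  have "v \<cdot> u = Ident C (Cod C q)"
    using is_cokernel_cancel[OF q Comp_Hom[OF u(1) v(1)] id(1)] Comp_assoc[OF qH u(1) v(1)]
      Ident_Comp[OF qH] u v by simp
  moreover have "u \<cdot> v = Ident C (Cod C r)"
    using is_cokernel_cancel[OF r Comp_Hom[OF v(1) u(1)] id(2)] Comp_assoc[OF rH v(1) u(1)]
      Ident_Comp[OF rH] u v by simp
  ultimately show ?thesis
    using is_isomorphism_iff[OF u(1)] v by blast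
qed

lemma is_cokernel_iso_comp:
  assumes q: "is_cokernel C q f" and u: "u \<in> Hom C (Cod C q) Q" "is_isomorphism C u"
  shows "is_cokernel C (u \<cdot> q) f"
proof -
  obtain v where v: "v \<in> Hom C Q (Cod C q)" "v \<cdot> u = Ident C (Cod C q)" "u \<cdot> v = Ident C Q"
    using u is_isomorphism_iff by blast
  have f: "f \<in> Hom C (Dom C f) (Cod C f)" and qH: "q \<in> Hom C (Cod C f) (Cod C q)"
    using is_cokernelD[OF q] by auto
  have q': "q \<cdot> f = Null C (Dom C f) (Cod C q)"
    "\<And>Z h. h \<in> Hom C (Cod C f) Z \<Longrightarrow> h \<cdot> f = Null C (Dom C f) Z
       \<Longrightarrow> \<exists>t. t \<in> Hom C (Cod C q) Z \<and> t \<cdot> q = h"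
    using iffD1[OF is_cokernel_iff[OF f qH] q] ex1_implies_ex by (simp, metis)
  have "\<exists>!t. t \<in> Hom C Q Z \<and> t \<cdot> (u \<cdot> q) = h"
    if h: "h \<in> Hom C (Cod C f) Z" "h \<cdot> f = Null C (Dom C f) Z" for Z h
  proof -
    obtain t where t: "t \<in> Hom C (Cod C q) Z" "t \<cdot> q = h"
      using q'(2) h by blast
    have "(t \<cdot> v) \<cdot> (u \<cdot> q) = h"
      using Comp_assoc[OF Comp_Hom[OF qH u(1)] v(1) t(1)] Comp_assoc[OF qH u(1) v(1)]
        Ident_Comp[OF qH] t v by simp
    moreover have "s = t \<cdot> v" if s: "s \<in> Hom C Q Z" "s \<cdot> (u \<cdot> q) = h" for s
    proof -
      have "s \<cdot> u = t"
        using is_cokernel_cancel[OF q Comp_Hom[OF u(1) s(1)] t(1)] Comp_assoc[OF qH u(1) s(1)] s t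
        by simp
      then show ?thesis
        using Comp_assoc[OF v(1) u(1) s(1)] v(3) Comp_Ident[OF s(1)] by simp
    qed
    ultimately show ?thesis
      using Comp_Hom[OF v(1) t(1)] by blast
  qed
  moreover have "(u \<cdot> q) \<cdot> f = Null C (Dom C f) Q"
    using Comp_assoc[OF f qH u(1)] q'(1) Comp_Null[OF u(1)] Hom_objects[OF f] by simp
  ultimately show ?thesis
    using is_cokernel_iff[OF f Comp_Hom[OF qH u(1)]] by blast
qed

lemma lift_eqI:
  assumes m: "is_kernel C m r" and u: "u \<in> Hom C (Dom C h) (Dom C m)" "m \<cdot> u = h"
  shows "lift C m h = u"
  unfolding lift_def
proof (rule the_equality)
  show "u \<in> Hom C (Dom C h) (Dom C m) \<and> m \<cdot> u = h"
    using u by blast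
  show "v = u" if "v \<in> Hom C (Dom C h) (Dom C m) \<and> m \<cdot> v = h" for v
    using is_kernel_cancel[OF m, of v "Dom C h" u] u that by simp
qed

section \<open>Morphisms out of a direct sum\<close>

text \<open>
  \<open>h \<langle>u, v\<rangle> = 0\<close> iff \<open>h u = 0\<close> and \<open>h v = 0\<close>, since the two injections of a direct sum are jointly epic. After this lemma the chosen direct sum and the copairing need not be mentioned again.
\<close>

lemma copair_is_cokernel_iff:
  assumes u: "u \<in> Hom C X Z" and v: "v \<in> Hom C Y Z"
  shows "is_cokernel C q (copair C u v) \<longleftrightarrow> q \<in> Hom C Z (Cod C q) \<and>
    q \<cdot> u = Null C X (Cod C q) \<and> q \<cdot> v = Null C Y (Cod C q) \<and>
    (\<forall>h W. h \<in> Hom C Z W \<and> h \<cdot> u = Null C X W \<and> h \<cdot> v = Null C Y W \<longrightarrow>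
      (\<exists>!t. t \<in> Hom C (Cod C q) W \<and> t \<cdot> q = h))"
    (is "_ \<longleftrightarrow> ?rhs")
proof -
  obtain i j p r where D: "direct_sum C X Y = (i, j, p, r)"
    by (metis prod_cases4)
  have "\<exists>x. case x of (i, j, p, q) \<Rightarrow> is_biproduct C X Y i j p q"
    using biproducts[of X Y] Hom_objects[OF u] Hom_objects[OF v] by auto
  then have "case direct_sum C X Y of (i, j, p, q) \<Rightarrow> is_biproduct C X Y i j p q"
    unfolding direct_sum_def by (rule someI_ex)
  then obtain P where P: "P \<in> Ob C" and i: "i \<in> Hom C X P" and j: "j \<in> Hom C Y P"
    and p: "p \<in> Hom C P X" and r: "r \<in> Hom C P Y"
    and eq: "p \<cdot> i = Ident C X" "r \<cdot> j = Ident C Y" "p \<cdot> j = Null C Y X" "r \<cdot> i = Null C X Y"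
      "Plus C (i \<cdot> p) (j \<cdot> r) = Ident C P"
    unfolding D is_biproduct_def by auto
  \<comment> \<open>A morphism out of the direct sum is determined by its restrictions to the summands.\<close>
  have expand: "w = Plus C ((w \<cdot> i) \<cdot> p) ((w \<cdot> j) \<cdot> r)" if w: "w \<in> Hom C P W" for w W
    using Comp_Plus[OF Comp_Hom[OF p i] Comp_Hom[OF r j] w] Comp_Ident[OF w] eq(5)
      Comp_assoc[OF p i w] Comp_assoc[OF r j w] by simp
  define w where "w = Plus C (u \<cdot> p) (v \<cdot> r)"
  have up: "u \<cdot> p \<in> Hom C P Z" and vr: "v \<cdot> r \<in> Hom C P Z"
    using Comp_Hom u v p r by blast+
  have ob: "X \<in> Ob C" "Y \<in> Ob C" "Z \<in> Ob C"
    using u v Hom_objects by blast+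
  interpret G: comm_group "hom_group C P Z"
    using hom_comm_group P ob by blast
  interpret GX: comm_group "hom_group C X Z"
    using hom_comm_group ob by blast
  interpret GY: comm_group "hom_group C Y Z"
    using hom_comm_group ob by blast
  have w: "w \<in> Hom C P Z"
    using G.m_closed up vr by (simp add: hom_group_def w_def)
  have "(u \<cdot> p) \<cdot> i = u" "(v \<cdot> r) \<cdot> i = Null C X Z" "(u \<cdot> p) \<cdot> j = Null C Y Z" "(v \<cdot> r) \<cdot> j = v"
    using Comp_assoc[OF i p u] Comp_assoc[OF i r v] Comp_assoc[OF j p u] Comp_assoc[OF j r v]
      eq Comp_Ident u v Comp_Null[OF u] Comp_Null[OF v] ob by auto
  then have wi: "w \<cdot> i = u" and wj: "w \<cdot> j = v"
    using Plus_Comp[OF i up vr] Plus_Comp[OF j up vr] GX.r_one[of u] GY.l_one[of v] u v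
    by (auto simp: w_def hom_group_def)
  have "(THE w. w \<in> Hom C (Cod C i) (Cod C u) \<and> w \<cdot> i = u \<and> w \<cdot> j = v) = w"
    using i u w wi wj expand w_def by (intro the_equality) (auto simp: Hom_def)
  then have cop: "copair C u v = w"
    using u v by (simp add: copair_def Hom_def D)
  have zero_iff: "h \<cdot> w = Null C P W \<longleftrightarrow> h \<cdot> u = Null C X W \<and> h \<cdot> v = Null C Y W"
    if h: "h \<in> Hom C Z W" for h W
  proof
    assume "h \<cdot> w = Null C P W"
    then show "h \<cdot> u = Null C X W \<and> h \<cdot> v = Null C Y W"
      using Comp_assoc[OF i w h] Comp_assoc[OF j w h] wi wj Null_Comp[OF i] Null_Comp[OF j]
        Hom_objects[OF h] by auto
  next
    assume "h \<cdot> u = Null C X W \<and> h \<cdot> v = Null C Y W"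
    then show "h \<cdot> w = Null C P W"
      using expand[OF Comp_Hom[OF w h]] Comp_assoc[OF i w h] Comp_assoc[OF j w h] wi wj
        Null_Comp[OF p] Null_Comp[OF r] Hom_objects[OF h] Null_Plus_Null[OF P] by auto
  qed
  then have zero_iff': "h \<in> Hom C Z W \<and> h \<cdot> w = Null C P W \<longleftrightarrow>
      h \<in> Hom C Z W \<and> h \<cdot> u = Null C X W \<and> h \<cdot> v = Null C Y W" for h W
    by blast
  have "is_cokernel C q w \<Longrightarrow> q \<in> Hom C Z (Cod C q)"
    using w is_cokernelD(2)[of q w] by (simp add: Hom_def)
  moreover have "is_cokernel C q w \<longleftrightarrow> ?rhs" if q: "q \<in> Hom C Z (Cod C q)"
    unfolding is_cokernel_iff[OF w q] zero_iff' using zero_iff[OF q] q by simp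
  ultimately show ?thesis
    unfolding cop by blast
qed

end

section \<open>Canonical decomposition\<close>

context quasi_abelian_category
begin

lemma ker_is_kernel: "f \<in> Ar C \<Longrightarrow> is_kernel C (ker C f) f"
  unfolding ker_def using kernels by (rule someI_ex)

lemma coker_is_cokernel: "f \<in> Ar C \<Longrightarrow> is_cokernel C (coker C f) f"
  unfolding coker_def using cokernels by (rule someI_ex)

lemma Hom_Ar: "f \<in> Hom C X Y \<Longrightarrow> f \<in> Ar C"
  by (simp add: Hom_def)

lemma ker_Hom: "f \<in> Hom C X Y \<Longrightarrow> ker C f \<in> Hom C (Ker C f) X"
  using is_kernelD[OF ker_is_kernel[of f]] by (simp add: Hom_def Ker_def)

lemma coker_Hom: "f \<in> Hom C X Y \<Longrightarrow> coker C f \<in> Hom C Y (Coker C f)"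
  using is_cokernelD[OF coker_is_cokernel[of f]] by (simp add: Hom_def Coker_def)

lemma Comp_ker: "f \<in> Hom C X Y \<Longrightarrow> f \<cdot> ker C f = Null C (Ker C f) Y"
  using is_kernelD[OF ker_is_kernel[of f]] by (simp add: Hom_def Ker_def)

lemma coker_Comp: "f \<in> Hom C X Y \<Longrightarrow> coker C f \<cdot> f = Null C X (Coker C f)"
  using is_cokernelD[OF coker_is_cokernel[of f]] by (simp add: Hom_def Coker_def)

lemma ker_factor:
  assumes "f \<in> Hom C X Y" "h \<in> Hom C W X" "f \<cdot> h = Null C W Y"
  obtains u where "u \<in> Hom C W (Ker C f)" "ker C f \<cdot> u = h"
proof -
  have "\<exists>!u. u \<in> Hom C W (Ker C f) \<and> ker C f \<cdot> u = h"
    using is_kernel_iff[OF assms(1) ker_Hom[OF assms(1)]] ker_is_kernel[OF Hom_Ar[OF assms(1)]]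
      assms(2,3) by simp
  then show ?thesis
    using that ex1_implies_ex by fast
qed

lemma coker_factor:
  assumes "f \<in> Hom C X Y" "h \<in> Hom C Y W" "h \<cdot> f = Null C X W"
  obtains u where "u \<in> Hom C (Coker C f) W" "u \<cdot> coker C f = h"
proof -
  have "\<exists>!u. u \<in> Hom C (Coker C f) W \<and> u \<cdot> coker C f = h"
    using is_cokernel_iff[OF assms(1) coker_Hom[OF assms(1)]]
      coker_is_cokernel[OF Hom_Ar[OF assms(1)]] assms(2,3) by simp
  then show ?thesis
    using that ex1_implies_ex by fast
qed

lemma ker_cancel:
  assumes "f \<in> Hom C X Y" "u \<in> Hom C W (Ker C f)" "v \<in> Hom C W (Ker C f)"
    "ker C f \<cdot> u = ker C f \<cdot> v"
  shows "u = v"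
  using assms by (intro is_kernel_cancel[OF ker_is_kernel[OF Hom_Ar[OF assms(1)]], of u W v])
    (auto simp: Ker_def)

lemma coker_cancel:
  assumes "f \<in> Hom C X Y" "u \<in> Hom C (Coker C f) W" "v \<in> Hom C (Coker C f) W"
    "u \<cdot> coker C f = v \<cdot> coker C f"
  shows "u = v"
  using assms by (intro is_cokernel_cancel[OF coker_is_cokernel[OF Hom_Ar[OF assms(1)]], of u W v])
    (auto simp: Coker_def)

lemma im_Hom: "f \<in> Hom C X Y \<Longrightarrow> im C f \<in> Hom C (Im C f) Y"
  using ker_Hom[OF coker_Hom, of f X Y] by (simp add: im_def Im_def Ker_def)

lemma im_is_kernel: "f \<in> Hom C X Y \<Longrightarrow> is_kernel C (im C f) (coker C f)"
  using ker_is_kernel[OF Hom_Ar[OF coker_Hom], of f X Y] by (simp add: im_def)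

lemma im_cancel:
  assumes "f \<in> Hom C X Y" "u \<in> Hom C W (Im C f)" "v \<in> Hom C W (Im C f)"
    "im C f \<cdot> u = im C f \<cdot> v"
  shows "u = v"
  using assms by (intro is_kernel_cancel[OF im_is_kernel[OF assms(1)], of u W v])
    (auto simp: Im_def)

lemma im_factor:
  assumes "f \<in> Hom C X Y" "h \<in> Hom C W Y" "coker C f \<cdot> h = Null C W (Coker C f)"
  obtains u where "u \<in> Hom C W (Im C f)" "im C f \<cdot> u = h"
  by (rule ker_factor[OF coker_Hom[OF assms(1)] assms(2,3)])
    (rule that, simp_all add: im_def Im_def Ker_def)

lemma coim_Hom: "f \<in> Hom C X Y \<Longrightarrow> coim C f \<in> Hom C X (Coim C f)"
  using coker_Hom[OF ker_Hom, of f X Y] by (simp add: coim_def Coim_def Coker_def)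

text \<open>
  \<open>f\<close> factors through \<open>ker (coker f)\<close>, and the resulting \<open>t\<close> has \<open>t \<cdot> ker f = 0\<close>, hence factors through
  \<open>coim f\<close>. The definite description in \<open>bar\<close> is justified by cancelling \<open>im f\<close> and \<open>coim f\<close>.
\<close>

lemma bar_decomposition:
  assumes f: "f \<in> Hom C X Y"
  shows "bar C f \<in> Hom C (Coim C f) (Im C f)" and "im C f \<cdot> (bar C f \<cdot> coim C f) = f"
proof -
  note i = im_Hom[OF f] and k = ker_Hom[OF f] and c = coim_Hom[OF f]
  obtain t where t: "t \<in> Hom C X (Im C f)" "im C f \<cdot> t = f"
    using im_factor[OF f f coker_Comp[OF f]] .
  have "im C f \<cdot> (t \<cdot> ker C f) = im C f \<cdot> Null C (Ker C f) (Im C f)"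
    using Comp_assoc[OF k t(1) i] t Comp_ker[OF f] Comp_Null[OF i] Hom_objects[OF k] by simp
  then have "t \<cdot> ker C f = Null C (Ker C f) (Im C f)"
    using im_cancel[OF f Comp_Hom[OF k t(1)] Null_Hom] Hom_objects[OF k] Hom_objects[OF i] by simp
  then obtain u where "u \<in> Hom C (Coker C (ker C f)) (Im C f)" "u \<cdot> coker C (ker C f) = t"
    using coker_factor[OF k t(1)] by metis
  then have u: "u \<in> Hom C (Coim C f) (Im C f)" "u \<cdot> coim C f = t"
    by (simp_all add: coim_def Coim_def Coker_def)
  have unique: "v = u"
    if v: "v \<in> Hom C (Coim C f) (Im C f)" "im C f \<cdot> (v \<cdot> coim C f) = f" for v
  proof -
    have "v \<cdot> coim C f = u \<cdot> coim C f"
      using im_cancel[OF f Comp_Hom[OF c v(1)] Comp_Hom[OF c u(1)]] v u t by simp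
    then show ?thesis
      using coker_cancel[OF k, of v "Im C f" u] v u by (simp add: coim_def Coim_def Coker_def)
  qed
  have "bar C f = u"
    unfolding bar_def
  proof (rule the_equality)
    show "u \<in> Hom C (Coim C f) (Im C f) \<and> im C f \<cdot> (u \<cdot> coim C f) = f"
      using u t by simp
  qed (rule unique, simp_all)
  then show "bar C f \<in> Hom C (Coim C f) (Im C f)" "im C f \<cdot> (bar C f \<cdot> coim C f) = f"
    using u t by auto
qed

lemma tilde_Hom: "f \<in> Hom C X Y \<Longrightarrow> tilde C f \<in> Hom C X (Im C f)"
  unfolding tilde_def using Comp_Hom[OF coim_Hom bar_decomposition(1)] .

lemma im_Comp_tilde: "f \<in> Hom C X Y \<Longrightarrow> im C f \<cdot> tilde C f = f"
  unfolding tilde_def by (rule bar_decomposition(2))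

lemma strict_imp_tilde_is_cokernel:
  assumes f: "f \<in> Hom C X Y" and "is_strict C f"
  shows "is_cokernel C (tilde C f) (ker C f)"
proof -
  have "is_cokernel C (coim C f) (ker C f)"
    using coker_is_cokernel[OF Hom_Ar[OF ker_Hom[OF f]]] by (simp add: coim_def)
  then show ?thesis
    unfolding tilde_def using bar_decomposition(1)[OF f] assms(2)
    by (intro is_cokernel_iso_comp) (simp_all add: Coim_def is_strict_def)
qed

text \<open>
  A morphism \<open>x\<close> with \<open>x m\<close> factoring through \<open>coker e\<close> satisfies \<open>x m e = 0\<close>, and so factors through
  \<open>coker (m e)\<close>. The pullback of a kernel is treated dually.
\<close>

lemma pushout_of_cokernel:
  assumes e: "e \<in> Hom C X Y" and m: "m \<in> Hom C Y Z"
    and n: "n \<in> Hom C (Coker C e) (Coker C (m \<cdot> e))" and sq: "coker C (m \<cdot> e) \<cdot> m = n \<cdot> coker C e"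
  shows "is_pushout C (coker C (m \<cdot> e)) n m (coker C e)"
proof -
  note me = Comp_Hom[OF e m]
  note q = coker_Hom[OF e] and q' = coker_Hom[OF me]
  have "\<exists>!u. u \<in> Hom C (Coker C (m \<cdot> e)) W \<and> u \<cdot> coker C (m \<cdot> e) = x \<and> u \<cdot> n = y"
    if x: "x \<in> Hom C Z W" and y: "y \<in> Hom C (Coker C e) W" and xy: "x \<cdot> m = y \<cdot> coker C e" for W x y
  proof -
    have "x \<cdot> (m \<cdot> e) = Null C X W"
      using Comp_assoc[OF e m x] Comp_assoc[OF e q y] xy coker_Comp[OF e] Comp_Null[OF y]
        Hom_objects[OF e] by simp
    then obtain u where u: "u \<in> Hom C (Coker C (m \<cdot> e)) W" "u \<cdot> coker C (m \<cdot> e) = x"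
      using coker_factor[OF me x] by blast
    have "(u \<cdot> n) \<cdot> coker C e = y \<cdot> coker C e"
      using Comp_assoc[OF q n u(1)] Comp_assoc[OF m q' u(1)] sq u xy by simp
    then have "u \<cdot> n = y"
      using coker_cancel[OF e Comp_Hom[OF n u(1)] y] by blast
    then show ?thesis
      using u by (intro ex1I[of _ u]) (simp, elim conjE, rule coker_cancel[OF me], simp_all)
  qed
  then show ?thesis
    using is_pushout_iff[OF m q q' n] sq by blast
qed

lemma pullback_of_kernel:
  assumes q: "q \<in> Hom C Y Z" and m: "m \<in> Hom C X Y"
    and n: "n \<in> Hom C (Ker C (q \<cdot> m)) (Ker C q)" and sq: "ker C q \<cdot> n = m \<cdot> ker C (q \<cdot> m)"
  shows "is_pullback C n (ker C (q \<cdot> m)) (ker C q) m"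
proof -
  note qm = Comp_Hom[OF m q]
  note k = ker_Hom[OF q] and k' = ker_Hom[OF qm]
  have "\<exists>!u. u \<in> Hom C W (Ker C (q \<cdot> m)) \<and> n \<cdot> u = x \<and> ker C (q \<cdot> m) \<cdot> u = y"
    if x: "x \<in> Hom C W (Ker C q)" and y: "y \<in> Hom C W X" and xy: "ker C q \<cdot> x = m \<cdot> y" for W x y
  proof -
    have "(q \<cdot> m) \<cdot> y = Null C W Z"
      using Comp_assoc[OF y m q] Comp_assoc[OF x k q] xy Comp_ker[OF q] Null_Comp[OF x]
        Hom_objects[OF q] by simp
    then obtain u where u: "u \<in> Hom C W (Ker C (q \<cdot> m))" "ker C (q \<cdot> m) \<cdot> u = y"
      using ker_factor[OF qm y] by blast
    have "ker C q \<cdot> (n \<cdot> u) = ker C q \<cdot> x"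
      using Comp_assoc[OF u(1) n k] Comp_assoc[OF u(1) k' m] sq u xy by simp
    then have "n \<cdot> u = x"
      using ker_cancel[OF q Comp_Hom[OF u(1) n] x] by blast
    then show ?thesis
      using u by (intro ex1I[of _ u]) (simp, elim conjE, rule ker_cancel[OF qm], simp_all)
  qed
  then show ?thesis
    using is_pullback_iff[OF k m n k'] sq by blast
qed

text \<open>
  The reason is that \<open>q = coker (tilde f)\<close> is zero. Since \<open>im f \<cdot> tilde f = f\<close>, the pushout of \<open>q\<close> along
  \<open>im f\<close> is \<open>coker f\<close>, and \<open>coker f \<cdot> im f = 0\<close>, so the fourth side \<open>n\<close> of the pushout square is zero.
  As a pushout of \<open>im f\<close> it is a monomorphism, and \<open>n q = 0\<close> gives \<open>q = 0\<close>.
\<close>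

lemma tilde_zero_cancel:
  assumes f: "f \<in> Hom C X Y" and h: "h \<in> Hom C (Im C f) W" and hf: "h \<cdot> tilde C f = Null C X W"
  shows "h = Null C (Im C f) W"
proof -
  note i = im_Hom[OF f] and t = tilde_Hom[OF f]
  define n where "n = Null C (Coker C (tilde C f)) (Coker C f)"
  note q = coker_Hom[OF t] and q' = coker_Hom[OF f]
  note ob = Hom_objects[OF q] Hom_objects[OF q'] Hom_objects[OF h]
  have n: "n \<in> Hom C (Coker C (tilde C f)) (Coker C f)"
    using Null_Hom ob by (auto simp: n_def)
  have "coker C f \<cdot> im C f = Null C (Im C f) (Coker C f)"
    using Comp_ker[OF q'] by (simp add: im_def Im_def Ker_def)
  then have "is_pushout C (coker C f) n (im C f) (coker C (tilde C f))"
    using pushout_of_cokernel[OF t i, of n] n Null_Comp[OF q] ob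
    by (auto simp: im_Comp_tilde[OF f] n_def)
  then have "\<exists>r. is_kernel C n r"
    using im_is_kernel[OF f] by (rule strict_mono_pushout[unfolded is_strict_mono_def, OF _ exI])
  then obtain r where r: "is_kernel C n r" ..
  have z: "Null C (Im C f) (Coker C (tilde C f)) \<in> Hom C (Im C f) (Coker C (tilde C f))"
    using Null_Hom ob by blast
  have "n \<cdot> coker C (tilde C f) = n \<cdot> Null C (Im C f) (Coker C (tilde C f))"
    using Null_Comp[OF q] Comp_Null[OF n] ob by (auto simp: n_def)
  moreover have "Dom C n = Coker C (tilde C f)"
    using n by (simp add: Hom_def)
  ultimately have "coker C (tilde C f) = Null C (Im C f) (Coker C (tilde C f))"
    using is_kernel_cancel[OF r, of "coker C (tilde C f)" "Im C f"] q z by simp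
  moreover obtain u where "u \<in> Hom C (Coker C (tilde C f)) W" "u \<cdot> coker C (tilde C f) = h"
    using coker_factor[OF t h hf] .
  ultimately show ?thesis
    using Comp_Null ob by metis
qed

end

section \<open>The canonical morphism for a diagram with exact rows\<close>

locale exact_rows_diagram = quasi_abelian_category +
  fixes A B Z A' B' Z' and f g f' g' a b c
  assumes f: "f \<in> Hom C A B" and g: "g \<in> Hom C B Z"
    and f': "f' \<in> Hom C A' B'" and g': "g' \<in> Hom C B' Z'"
    and a: "a \<in> Hom C A A'" and b: "b \<in> Hom C B B'" and c: "c \<in> Hom C Z Z'"
    and left_commutes: "b \<cdot> f = f' \<cdot> a" and right_commutes: "c \<cdot> g = g' \<cdot> b"
    and top_exact: "is_exact C f g" and bottom_exact: "is_exact C f' g'"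
begin

definition "S = \<lparr>sq_top = f, sq_left = a, sq_bottom = f', sq_right = b\<rparr>"
definition "T = \<lparr>sq_top = g, sq_left = b, sq_bottom = g', sq_right = c\<rparr>"

abbreviation "kS \<equiv> sq_k C S"
abbreviation "lS \<equiv> sq_l C S"
abbreviation "IS \<equiv> sq_I C S"
abbreviation "\<rho> \<equiv> sq_rho C S"
abbreviation "\<mu> \<equiv> sq_mu C T"
abbreviation "\<nu> \<equiv> sq_nu C T"
abbreviation "\<kappa> \<equiv> ker C (g' \<cdot> b)"
abbreviation "\<xi> \<equiv> xi C S T"

lemma bf: "b \<cdot> f \<in> Hom C A B'" and g'b: "g' \<cdot> b \<in> Hom C B Z'"
  using Comp_Hom f b g' by blast+

lemmas im_b = im_Hom[OF b] and im_f' = im_Hom[OF f'] and tilde_b = tilde_Hom[OF b]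
  and im_bf = im_Hom[OF bf] and \<kappa>_Hom = ker_Hom[OF g'b]

text \<open>
  As \<open>im b\<close> is a kernel of \<open>coker b\<close>, the pullback can be taken to be \<open>ker (coker b \<cdot> im f')\<close>; this shows
  that the choice made in \<open>im_pullback\<close> is a pullback.
\<close>

lemma I_pullback: "is_pullback C kS lS (im C b) (im C f')"
proof -
  define l where "l = ker C (coker C b \<cdot> im C f')"
  have sq: "sq_right S = b" "sq_bottom S = f'"
    by (simp_all add: S_def)
  note q = coker_Hom[OF b]
  note qi = Comp_Hom[OF im_f' q]
  have l: "l \<in> Hom C (Ker C (coker C b \<cdot> im C f')) (Im C f')"
    using ker_Hom[OF qi] by (simp add: l_def)
  have "coker C b \<cdot> (im C f' \<cdot> l) = Null C (Ker C (coker C b \<cdot> im C f')) (Coker C b)"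
    using Comp_assoc[OF l im_f' q] Comp_ker[OF qi] by (simp add: l_def)
  then obtain n where "n \<in> Hom C (Ker C (coker C b \<cdot> im C f')) (Im C b)" "im C b \<cdot> n = im C f' \<cdot> l"
    using im_factor[OF b Comp_Hom[OF l im_f']] by blast
  then have "is_pullback C n l (im C b) (im C f')"
    using pullback_of_kernel[OF q im_f'] by (simp add: l_def im_def Im_def Ker_def)
  then have "\<exists>x. case x of (k, l) \<Rightarrow> is_pullback C k l (im C b) (im C f')"
    by (intro exI[of _ "(n, l)"]) simp
  then have "case im_pullback C S of (k, l) \<Rightarrow> is_pullback C k l (im C b) (im C f')"
    unfolding im_pullback_def by (simp only: sq) (rule someI_ex)
  then show ?thesis
    by (auto simp: sq_k_def sq_l_def split: prod.splits)
qed

lemma kS: "kS \<in> Hom C IS (Im C b)" and lS: "lS \<in> Hom C IS (Im C f')"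
  and I_square: "im C b \<cdot> kS = im C f' \<cdot> lS"
  using is_pullbackD[OF I_pullback] by (simp_all add: sq_I_def Im_def)

lemma I_factor:
  assumes "x \<in> Hom C W (Im C b)" "y \<in> Hom C W (Im C f')" "im C b \<cdot> x = im C f' \<cdot> y"
  obtains u where "u \<in> Hom C W IS" "kS \<cdot> u = x" "lS \<cdot> u = y"
proof -
  have "\<exists>!u. u \<in> Hom C W IS \<and> kS \<cdot> u = x \<and> lS \<cdot> u = y"
    using iffD1[OF is_pullback_iff[OF im_b im_f' kS lS] I_pullback] assms by simp
  then show ?thesis
    using that ex1_implies_ex by fast
qed

text \<open>
  \<open>k\<^sub>S\<close> is a pullback of the monomorphism \<open>im f'\<close>. So equations between morphisms into \<open>I\<^sub>S\<close> can be
  tested after composing with \<open>k\<^sub>S\<close> alone.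
\<close>

lemma kS_cancel:
  assumes u: "u \<in> Hom C W IS" and v: "v \<in> Hom C W IS" and eq: "kS \<cdot> u = kS \<cdot> v"
  shows "u = v"
proof -
  have "im C f' \<cdot> (lS \<cdot> u) = im C f' \<cdot> (lS \<cdot> v)"
    using I_square eq Comp_assoc[OF u kS im_b] Comp_assoc[OF v kS im_b] Comp_assoc[OF u lS im_f']
      Comp_assoc[OF v lS im_f'] by simp
  then have "lS \<cdot> u = lS \<cdot> v"
    using im_cancel[OF f'] Comp_Hom[OF u lS] Comp_Hom[OF v lS] by blast
  moreover have "im C b \<cdot> (kS \<cdot> u) = im C f' \<cdot> (lS \<cdot> u)"
    using I_square Comp_assoc[OF u kS im_b] Comp_assoc[OF u lS im_f'] by simp
  ultimately have "\<exists>!w. w \<in> Hom C W IS \<and> kS \<cdot> w = kS \<cdot> u \<and> lS \<cdot> w = lS \<cdot> u"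
    using iffD1[OF is_pullback_iff[OF im_b im_f' kS lS] I_pullback] Comp_Hom[OF u kS]
      Comp_Hom[OF u lS] by simp
  then show ?thesis
    using eq u v \<open>lS \<cdot> u = lS \<cdot> v\<close> by auto
qed

lemma rho: "\<rho> \<in> Hom C (Im C (b \<cdot> f)) IS" and im_b_kS_rho: "im C b \<cdot> (kS \<cdot> \<rho>) = im C (b \<cdot> f)"
proof -
  \<comment> \<open>Applied to \<open>b f\<close> and to \<open>f' a\<close>, the two ways of writing the diagonal of the square.\<close>
  have factor: "\<exists>x. x \<in> Hom C (Im C (b \<cdot> f)) (Im C s) \<and> im C s \<cdot> x = im C (b \<cdot> f)"
    if s: "s \<in> Hom C X B'" and t: "t \<in> Hom C A X" and st: "b \<cdot> f = s \<cdot> t" for s t X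
  proof -
    note q = coker_Hom[OF s]
    have "coker C s \<cdot> (b \<cdot> f) = Null C A (Coker C s)"
      using st Comp_assoc[OF t s q] coker_Comp[OF s] Null_Comp[OF t] Hom_objects[OF q] by simp
    then obtain v where v: "v \<in> Hom C (Coker C (b \<cdot> f)) (Coker C s)" "v \<cdot> coker C (b \<cdot> f) = coker C s"
      using coker_factor[OF bf q] by blast
    have "coker C (b \<cdot> f) \<cdot> im C (b \<cdot> f) = Null C (Im C (b \<cdot> f)) (Coker C (b \<cdot> f))"
      using Comp_ker[OF coker_Hom[OF bf]] by (simp add: im_def Im_def Ker_def)
    then have z: "coker C s \<cdot> im C (b \<cdot> f) = Null C (Im C (b \<cdot> f)) (Coker C s)"
      using v Comp_assoc[OF im_bf coker_Hom[OF bf] v(1)] Comp_Null[OF v(1)] Hom_objects[OF im_bf]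
      by simp
    show ?thesis
      by (rule im_factor[OF s im_bf z]) blast
  qed
  obtain x where x: "x \<in> Hom C (Im C (b \<cdot> f)) (Im C b)" "im C b \<cdot> x = im C (b \<cdot> f)"
    using factor[OF b f refl] by blast
  obtain y where y: "y \<in> Hom C (Im C (b \<cdot> f)) (Im C f')" "im C f' \<cdot> y = im C (b \<cdot> f)"
    using factor[OF f' a left_commutes] by blast
  obtain u where u: "u \<in> Hom C (Im C (b \<cdot> f)) IS" "kS \<cdot> u = x" "lS \<cdot> u = y"
    using I_factor[OF x(1) y(1) trans[OF x(2) y(2)[symmetric]]] .
  have "lift C (im C b) (im C (b \<cdot> f)) = x" "lift C (im C f') (im C (b \<cdot> f)) = y"
    using lift_eqI[OF im_is_kernel[OF b], of x "im C (b \<cdot> f)"]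
      lift_eqI[OF im_is_kernel[OF f'], of y "im C (b \<cdot> f)"] x y
    by (simp_all add: Im_def)
  moreover have "diagonal C S = b \<cdot> f" "sq_right S = b" "sq_bottom S = f'"
    by (simp_all add: diagonal_def S_def)
  ultimately have "\<rho> = (THE r. r \<in> Hom C (Im C (b \<cdot> f)) IS \<and> kS \<cdot> r = x \<and> lS \<cdot> r = y)"
    by (simp add: sq_rho_def)
  also have "\<dots> = u"
  proof (rule the_equality)
    show "v = u" if "v \<in> Hom C (Im C (b \<cdot> f)) IS \<and> kS \<cdot> v = x \<and> lS \<cdot> v = y" for v
      using kS_cancel[of v "Im C (b \<cdot> f)" u] that u by simp
  qed (use u in simp)
  finally have "\<rho> = u" .
  then show "\<rho> \<in> Hom C (Im C (b \<cdot> f)) IS" "im C b \<cdot> (kS \<cdot> \<rho>) = im C (b \<cdot> f)"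
    using u x by simp_all
qed

text \<open>
  Both inclusions exist because \<open>g' b\<close> factors through \<open>b\<close> and, the right square being commutative,
  through \<open>g\<close>.
\<close>

lemma mu: "\<mu> \<in> Hom C (Ker C b) (Ker C (g' \<cdot> b))" and \<kappa>_mu: "\<kappa> \<cdot> \<mu> = ker C b"
  and nu: "\<nu> \<in> Hom C (Ker C g) (Ker C (g' \<cdot> b))" and \<kappa>_nu: "\<kappa> \<cdot> \<nu> = ker C g"
proof -
  have lift: "lift C \<kappa> (ker C s) \<in> Hom C (Ker C s) (Ker C (g' \<cdot> b)) \<and> \<kappa> \<cdot> lift C \<kappa> (ker C s) = ker C s"
    if s: "s \<in> Hom C B X" and t: "t \<in> Hom C X Z'" and st: "t \<cdot> s = g' \<cdot> b" for s t X
  proof -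
    note k = ker_Hom[OF s]
    have "(g' \<cdot> b) \<cdot> ker C s = Null C (Ker C s) Z'"
      using st[symmetric] Comp_assoc[OF k s t] Comp_ker[OF s] Comp_Null[OF t] Hom_objects[OF k]
      by simp
    then obtain u where "u \<in> Hom C (Ker C s) (Ker C (g' \<cdot> b))" "\<kappa> \<cdot> u = ker C s"
      using ker_factor[OF g'b k] by blast
    moreover from this have "lift C \<kappa> (ker C s) = u"
      using lift_eqI[OF ker_is_kernel[OF Hom_Ar[OF g'b]], of u "ker C s"] by (simp add: Ker_def)
    ultimately show ?thesis
      by simp
  qed
  have "diagonal C T = g' \<cdot> b" "sq_left T = b" "sq_top T = g"
    by (simp_all add: diagonal_def T_def right_commutes)
  then show "\<mu> \<in> Hom C (Ker C b) (Ker C (g' \<cdot> b))" "\<kappa> \<cdot> \<mu> = ker C b"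
    "\<nu> \<in> Hom C (Ker C g) (Ker C (g' \<cdot> b))" "\<kappa> \<cdot> \<nu> = ker C g"
    using lift[OF b g' refl] lift[OF g c right_commutes] by (simp_all add: sq_mu_def sq_nu_def)
qed

lemma bottom_exactD:
  assumes h: "h \<in> Hom C W B'" and z: "g' \<cdot> h = Null C W Z'"
  obtains y where "y \<in> Hom C W (Im C f')" "im C f' \<cdot> y = h"
proof -
  obtain u where u: "u \<in> Hom C (Im C f') (Ker C g')" "is_isomorphism C u" "ker C g' \<cdot> u = im C f'"
    using bottom_exact unfolding is_exact_def same_subobject_def Im_def Ker_def by blast
  then obtain v where v: "v \<in> Hom C (Ker C g') (Im C f')" "u \<cdot> v = Ident C (Ker C g')"
    using is_isomorphism_iff by blast
  obtain t where t: "t \<in> Hom C W (Ker C g')" "ker C g' \<cdot> t = h"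
    using ker_factor[OF g' h z] .
  have "im C f' \<cdot> (v \<cdot> t) = h"
    using u v t Comp_assoc[OF Comp_Hom[OF t(1) v(1)] u(1) ker_Hom[OF g']]
      Comp_assoc[OF t(1) v(1) u(1)] Ident_Comp[OF t(1)] by simp
  then show ?thesis
    using that Comp_Hom[OF t(1) v(1)] by blast
qed

lemma g'_im_f': "g' \<cdot> im C f' = Null C (Im C f') Z'"
proof -
  obtain u where u: "u \<in> Hom C (Im C f') (Ker C g')" "ker C g' \<cdot> u = im C f'"
    using bottom_exact unfolding is_exact_def same_subobject_def Im_def Ker_def by blast
  then show ?thesis
    using Comp_assoc[OF u(1) ker_Hom[OF g'] g'] Comp_ker[OF g'] Null_Comp[OF u(1)] Hom_objects[OF g']
    by simp
qed

text \<open>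
  \<open>b \<kappa>\<close> factors through \<open>im b\<close> as \<open>tilde b \<kappa>\<close>, and through \<open>im f'\<close> because \<open>g' b \<kappa> = 0\<close> and the
  bottom row is exact; the pullback \<open>I\<^sub>S\<close> combines the two factorizations.
\<close>

lemma xi: "\<xi> \<in> Hom C (Ker C (g' \<cdot> b)) IS" and kS_xi: "kS \<cdot> \<xi> = tilde C b \<cdot> \<kappa>"
proof -
  note k = \<kappa>_Hom
  have "g' \<cdot> (b \<cdot> \<kappa>) = Null C (Ker C (g' \<cdot> b)) Z'"
    using Comp_assoc[OF k b g'] Comp_ker[OF g'b] by simp
  then obtain y where y: "y \<in> Hom C (Ker C (g' \<cdot> b)) (Im C f')" "im C f' \<cdot> y = b \<cdot> \<kappa>"
    using bottom_exactD[OF Comp_Hom[OF k b]] by blast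
  have "im C b \<cdot> (tilde C b \<cdot> \<kappa>) = im C f' \<cdot> y"
    using y Comp_assoc[OF k tilde_b im_b] im_Comp_tilde[OF b] by simp
  then obtain u where u: "u \<in> Hom C (Ker C (g' \<cdot> b)) IS" "kS \<cdot> u = tilde C b \<cdot> \<kappa>" "lS \<cdot> u = y"
    using I_factor[OF Comp_Hom[OF k tilde_b] y(1)] by blast
  have "\<xi> = (THE v. v \<in> Hom C (Ker C (g' \<cdot> b)) IS \<and> kS \<cdot> v = tilde C b \<cdot> \<kappa> \<and>
      im C f' \<cdot> (lS \<cdot> v) = b \<cdot> \<kappa>)"
    by (simp add: xi_def Let_def Ker_def S_def T_def)
  also have "\<dots> = u"
  proof (rule the_equality)
    show "v = u" if "v \<in> Hom C (Ker C (g' \<cdot> b)) IS \<and> kS \<cdot> v = tilde C b \<cdot> \<kappa> \<and>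
        im C f' \<cdot> (lS \<cdot> v) = b \<cdot> \<kappa>" for v
      using kS_cancel[of v "Ker C (g' \<cdot> b)" u] that u by simp
  qed (use u y in simp)
  finally have "\<xi> = u" .
  then show "\<xi> \<in> Hom C (Ker C (g' \<cdot> b)) IS" "kS \<cdot> \<xi> = tilde C b \<cdot> \<kappa>"
    using u by simp_all
qed

text \<open>
  For \<open>tilde b x = k\<^sub>S y\<close> one has \<open>b x = im b k\<^sub>S y = im f' l\<^sub>S y\<close>, so \<open>g' b x = 0\<close> and \<open>x = \<kappa> u\<close> for a
  unique \<open>u\<close>; cancelling \<open>k\<^sub>S\<close> then yields \<open>\<xi> u = y\<close>.
\<close>

lemma xi_pullback: "is_pullback C \<kappa> \<xi> (tilde C b) kS"
proof -
  have "\<exists>!u. u \<in> Hom C W (Ker C (g' \<cdot> b)) \<and> \<kappa> \<cdot> u = x \<and> \<xi> \<cdot> u = y"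
    if x: "x \<in> Hom C W B" and y: "y \<in> Hom C W IS" and xy: "tilde C b \<cdot> x = kS \<cdot> y" for W x y
  proof -
    note ly = Comp_Hom[OF y lS]
    have "b \<cdot> x = im C f' \<cdot> (lS \<cdot> y)"
      using im_Comp_tilde[OF b] Comp_assoc[OF x tilde_b im_b] xy Comp_assoc[OF y kS im_b] I_square
        Comp_assoc[OF y lS im_f'] by simp
    then have "(g' \<cdot> b) \<cdot> x = Null C W Z'"
      using Comp_assoc[OF x b g'] Comp_assoc[OF ly im_f' g'] g'_im_f' Null_Comp[OF ly]
        Hom_objects[OF g'] by simp
    then obtain u where u: "u \<in> Hom C W (Ker C (g' \<cdot> b))" "\<kappa> \<cdot> u = x"
      using ker_factor[OF g'b x] by blast
    have "kS \<cdot> (\<xi> \<cdot> u) = kS \<cdot> y"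
      using Comp_assoc[OF u(1) xi kS] Comp_assoc[OF u(1) \<kappa>_Hom tilde_b] kS_xi u xy by simp
    then have "\<xi> \<cdot> u = y"
      using kS_cancel Comp_Hom[OF u(1) xi] y by blast
    then show ?thesis
      using u by (intro ex1I[of _ u]) (simp, elim conjE, rule ker_cancel[OF g'b], simp_all)
  qed
  then show ?thesis
    using is_pullback_iff[OF tilde_b kS \<kappa>_Hom xi] kS_xi by simp
qed

lemma tilde_b_zero_iff:
  assumes x: "x \<in> Hom C W B"
  shows "tilde C b \<cdot> x = Null C W (Im C b) \<longleftrightarrow> b \<cdot> x = Null C W B'"
proof
  have *: "im C b \<cdot> (tilde C b \<cdot> x) = b \<cdot> x" "im C b \<cdot> Null C W (Im C b) = Null C W B'"
    using Comp_assoc[OF x tilde_b im_b] im_Comp_tilde[OF b] Comp_Null[OF im_b] Hom_objects[OF x]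
    by auto
  show "b \<cdot> x = Null C W B'" if "tilde C b \<cdot> x = Null C W (Im C b)"
    using that * by simp
  show "tilde C b \<cdot> x = Null C W (Im C b)" if "b \<cdot> x = Null C W B'"
    using im_cancel[OF b Comp_Hom[OF x tilde_b] Null_Hom] * that Hom_objects[OF x]
      Hom_objects[OF im_b] by simp
qed

lemma xi_zero_iff:
  assumes u: "u \<in> Hom C W (Ker C (g' \<cdot> b))"
  shows "\<xi> \<cdot> u = Null C W IS \<longleftrightarrow> b \<cdot> (\<kappa> \<cdot> u) = Null C W B'"
proof -
  have "kS \<cdot> (\<xi> \<cdot> u) = tilde C b \<cdot> (\<kappa> \<cdot> u)"
    using Comp_assoc[OF u xi kS] Comp_assoc[OF u \<kappa>_Hom tilde_b] kS_xi by simp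
  moreover have "kS \<cdot> Null C W IS = Null C W (Im C b)"
    using Comp_Null[OF kS] Hom_objects[OF u] by simp
  ultimately have "\<xi> \<cdot> u = Null C W IS \<longleftrightarrow> tilde C b \<cdot> (\<kappa> \<cdot> u) = Null C W (Im C b)"
    using kS_cancel[OF Comp_Hom[OF u xi] Null_Hom] Hom_objects[OF u] Hom_objects[OF xi] by metis
  then show ?thesis
    using tilde_b_zero_iff[OF Comp_Hom[OF u \<kappa>_Hom]] by simp
qed

text \<open>
  Let \<open>s\<close> be the isomorphism \<open>Im f \<rightarrow> Ker g\<close> given by exactness of the top row. The key identity is
  \<open>\<xi> \<nu>\<^sub>T s tilde f = \<rho>\<^sub>S tilde (b f)\<close>: composed with the monomorphism \<open>im b k\<^sub>S\<close>, both sides become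
  \<open>b f\<close>. The claim follows by cancelling \<open>tilde f\<close>, \<open>s\<close> and \<open>tilde (b f)\<close>.
\<close>

lemma xi_nu_zero_iff:
  assumes h: "h \<in> Hom C IS W"
  shows "(h \<cdot> \<xi>) \<cdot> \<nu> = Null C (Ker C g) W \<longleftrightarrow> h \<cdot> \<rho> = Null C (Im C (b \<cdot> f)) W"
proof -
  note i = im_Hom[OF f] and t = tilde_Hom[OF f] and t' = tilde_Hom[OF bf]
  obtain s where s: "s \<in> Hom C (Im C f) (Ker C g)" "is_isomorphism C s" "ker C g \<cdot> s = im C f"
    using top_exact unfolding is_exact_def same_subobject_def Im_def Ker_def by blast
  then obtain s' where s': "s' \<in> Hom C (Ker C g) (Im C f)" "s \<cdot> s' = Ident C (Ker C g)"
    using is_isomorphism_iff by blast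
  note ob = Hom_objects[OF h] Hom_objects[OF t] Hom_objects[OF t'] Hom_objects[OF s(1)]
  note ns = Comp_Hom[OF s(1) nu]
  note nst = Comp_Hom[OF t ns]
  have "kS \<cdot> (\<xi> \<cdot> ((\<nu> \<cdot> s) \<cdot> tilde C f)) = tilde C b \<cdot> (\<kappa> \<cdot> ((\<nu> \<cdot> s) \<cdot> tilde C f))"
    using Comp_assoc[OF nst xi kS] Comp_assoc[OF nst \<kappa>_Hom tilde_b] kS_xi by simp
  also have "\<kappa> \<cdot> ((\<nu> \<cdot> s) \<cdot> tilde C f) = f"
    using Comp_assoc[OF t ns \<kappa>_Hom] Comp_assoc[OF s(1) nu \<kappa>_Hom] \<kappa>_nu s(3) im_Comp_tilde[OF f]
    by simp
  also have "tilde C b \<cdot> f = kS \<cdot> (\<rho> \<cdot> tilde C (b \<cdot> f))"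
  proof (rule im_cancel[OF b])
    show "im C b \<cdot> (tilde C b \<cdot> f) = im C b \<cdot> (kS \<cdot> (\<rho> \<cdot> tilde C (b \<cdot> f)))"
      using Comp_assoc[OF f tilde_b im_b] im_Comp_tilde[OF b] im_Comp_tilde[OF bf] im_b_kS_rho
        Comp_assoc[OF t' rho kS] Comp_assoc[OF t' Comp_Hom[OF rho kS] im_b] by simp
  qed (use Comp_Hom f tilde_b t' rho kS in blast)+
  finally have "\<xi> \<cdot> ((\<nu> \<cdot> s) \<cdot> tilde C f) = \<rho> \<cdot> tilde C (b \<cdot> f)"
    using kS_cancel Comp_Hom[OF nst xi] Comp_Hom[OF t' rho] by blast
  then have eq: "(((h \<cdot> \<xi>) \<cdot> \<nu>) \<cdot> s) \<cdot> tilde C f = (h \<cdot> \<rho>) \<cdot> tilde C (b \<cdot> f)"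
    using Comp_assoc[OF nst xi h] Comp_assoc[OF t' rho h] Comp_assoc[OF t ns Comp_Hom[OF xi h]]
      Comp_assoc[OF s(1) nu Comp_Hom[OF xi h]] by simp
  note hn = Comp_Hom[OF nu Comp_Hom[OF xi h]]
  show ?thesis
  proof
    assume "(h \<cdot> \<xi>) \<cdot> \<nu> = Null C (Ker C g) W"
    then have "(h \<cdot> \<rho>) \<cdot> tilde C (b \<cdot> f) = Null C A W"
      using eq Null_Comp[OF s(1)] Null_Comp[OF t] ob by simp
    then show "h \<cdot> \<rho> = Null C (Im C (b \<cdot> f)) W"
      using tilde_zero_cancel[OF bf Comp_Hom[OF rho h]] by blast
  next
    assume "h \<cdot> \<rho> = Null C (Im C (b \<cdot> f)) W"
    then have "(((h \<cdot> \<xi>) \<cdot> \<nu>) \<cdot> s) \<cdot> tilde C f = Null C A W"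
      using eq Null_Comp[OF t'] ob by simp
    then have "((h \<cdot> \<xi>) \<cdot> \<nu>) \<cdot> s = Null C (Im C f) W"
      using tilde_zero_cancel[OF f Comp_Hom[OF s(1) hn]] by blast
    then show "(h \<cdot> \<xi>) \<cdot> \<nu> = Null C (Ker C g) W"
      using Comp_assoc[OF s'(1) s(1) hn] s'(2) Comp_Ident[OF hn] Null_Comp[OF s'(1)] ob by simp
  qed
qed

text \<open>
  The strict epimorphism \<open>\<xi>\<close> is the cokernel of some \<open>\<phi>\<close>. From \<open>\<xi> \<phi> = 0\<close> it follows that
  \<open>b \<kappa> \<phi> = 0\<close>, hence \<open>\<phi> = \<mu>\<^sub>T t\<close>. Thus \<open>h \<mu>\<^sub>T = 0\<close> implies \<open>h \<phi> = 0\<close>, so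
  \<open>h = h' \<xi>\<close>; if moreover \<open>h \<nu>\<^sub>T = 0\<close>, then \<open>h' \<rho>\<^sub>S = 0\<close> and \<open>h'\<close> factors through \<open>coker \<rho>\<^sub>S\<close>.
\<close>

lemma coker_rho_xi_is_cokernel:
  assumes "is_strict C b"
  shows "is_cokernel C (coker C \<rho> \<cdot> \<xi>) (copair C \<mu> \<nu>)"
proof -
  have "\<exists>\<phi>. is_cokernel C \<xi> \<phi>"
    using strict_imp_tilde_is_cokernel[OF b assms]
    by (rule strict_epi_pullback[OF xi_pullback, unfolded is_strict_epi_def, OF exI])
  then obtain \<phi> where \<phi>: "is_cokernel C \<xi> \<phi>" ..
  have \<phi>H: "\<phi> \<in> Hom C (Dom C \<phi>) (Ker C (g' \<cdot> b))"
    using is_cokernelD(1)[OF \<phi>] is_cokernelD(2)[OF \<phi>] xi by (simp add: Hom_def)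
  note q = coker_Hom[OF rho]
  note qx = Comp_Hom[OF xi q]
  have cod: "Cod C (coker C \<rho> \<cdot> \<xi>) = Coker C \<rho>" "Cod C \<xi> = IS"
    using qx xi by (auto simp: Hom_def)
  have "\<xi> \<cdot> \<phi> = Null C (Dom C \<phi>) IS"
    using \<phi> is_cokernel_iff[OF \<phi>H xi] by blast
  then have "b \<cdot> (\<kappa> \<cdot> \<phi>) = Null C (Dom C \<phi>) B'"
    using xi_zero_iff[OF \<phi>H] by blast
  then obtain t where t: "t \<in> Hom C (Dom C \<phi>) (Ker C b)" "ker C b \<cdot> t = \<kappa> \<cdot> \<phi>"
    using ker_factor[OF b Comp_Hom[OF \<phi>H \<kappa>_Hom]] by blast
  then have \<mu>t: "\<mu> \<cdot> t = \<phi>"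
    using ker_cancel[OF g'b Comp_Hom[OF t(1) mu] \<phi>H] Comp_assoc[OF t(1) mu \<kappa>_Hom] \<kappa>_mu by simp
  have "\<xi> \<cdot> \<mu> = Null C (Ker C b) IS"
    using xi_zero_iff[OF mu] \<kappa>_mu Comp_ker[OF b] by simp
  then have "(coker C \<rho> \<cdot> \<xi>) \<cdot> \<mu> = Null C (Ker C b) (Coker C \<rho>)"
    using Comp_assoc[OF mu xi q] Comp_Null[OF q] Hom_objects[OF mu] by simp
  moreover have "(coker C \<rho> \<cdot> \<xi>) \<cdot> \<nu> = Null C (Ker C g) (Coker C \<rho>)"
    using xi_nu_zero_iff[OF q] coker_Comp[OF rho] by blast
  moreover have "\<exists>!u. u \<in> Hom C (Coker C \<rho>) W \<and> u \<cdot> (coker C \<rho> \<cdot> \<xi>) = h"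
    if h: "h \<in> Hom C (Ker C (g' \<cdot> b)) W" and hm: "h \<cdot> \<mu> = Null C (Ker C b) W"
      and hn: "h \<cdot> \<nu> = Null C (Ker C g) W" for W h
  proof -
    have "h \<cdot> \<phi> = Null C (Dom C \<phi>) W"
      using Comp_assoc[OF t(1) mu h] \<mu>t hm Null_Comp[OF t(1)] Hom_objects[OF h] by simp
    then obtain h' where h': "h' \<in> Hom C IS W" "h' \<cdot> \<xi> = h"
      using \<phi> is_cokernel_iff[OF \<phi>H xi] h by blast
    then have "h' \<cdot> \<rho> = Null C (Im C (b \<cdot> f)) W"
      using xi_nu_zero_iff hn by blast
    then obtain u where u: "u \<in> Hom C (Coker C \<rho>) W" "u \<cdot> coker C \<rho> = h'"
      using coker_factor[OF rho h'(1)] by blast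
    have "v = u" if v: "v \<in> Hom C (Coker C \<rho>) W" "v \<cdot> (coker C \<rho> \<cdot> \<xi>) = h" for v
    proof -
      have "v \<cdot> coker C \<rho> = u \<cdot> coker C \<rho>"
        using is_cokernel_cancel[OF \<phi>, of "v \<cdot> coker C \<rho>" W h'] Comp_Hom[OF q v(1)] h' u v
          Comp_assoc[OF xi q v(1)] by (simp add: cod)
      then show ?thesis
        using coker_cancel[OF rho v(1) u(1)] by blast
    qed
    moreover have "u \<cdot> (coker C \<rho> \<cdot> \<xi>) = h"
      using Comp_assoc[OF xi q u(1)] u h' by simp
    ultimately show ?thesis
      using u by blast
  qed
  ultimately show ?thesis
    using copair_is_cokernel_iff[OF mu nu] qx cod by auto
qed

lemma zeta_iso:
  assumes "is_strict C b"
  shows "zeta C S T \<in> Hom C (sq_Ker C T) (sq_Im C S) \<and> is_isomorphism C (zeta C S T)"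
proof -
  let ?p = "copair C \<mu> \<nu>"
  note r = coker_rho_xi_is_cokernel[OF assms]
  have "?p \<in> Ar C"
    using r by (simp add: is_cokernel_def)
  note q = coker_is_cokernel[OF this]
  have Im: "Cod C (coker C \<rho> \<cdot> \<xi>) = sq_Im C S"
    using Comp_Hom[OF xi coker_Hom[OF rho]] by (auto simp: sq_Im_def Hom_def)
  have "\<exists>!z. z \<in> Hom C (sq_Ker C T) (sq_Im C S) \<and> z \<cdot> coker C ?p = coker C \<rho> \<cdot> \<xi>"
    using q r Im unfolding is_cokernel_def sq_Ker_def Coker_def by metis
  then obtain z where z: "z \<in> Hom C (sq_Ker C T) (sq_Im C S)" "z \<cdot> coker C ?p = coker C \<rho> \<cdot> \<xi>"
    and unique: "\<And>z'. z' \<in> Hom C (sq_Ker C T) (sq_Im C S) \<Longrightarrow> z' \<cdot> coker C ?p = coker C \<rho> \<cdot> \<xi> \<Longrightarrow> z' = z"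
    by blast
  have "zeta C S T = z"
    unfolding zeta_def
  proof (rule the_equality)
    show "z \<in> Hom C (sq_Ker C T) (sq_Im C S) \<and> coker C \<rho> \<cdot> \<xi> = z \<cdot> coker C ?p"
      using z by simp
  qed (rule unique, simp_all)
  moreover have "is_isomorphism C z"
    using is_cokernel_unique_up_to_iso[OF q r] z by (simp add: Im sq_Ker_def Coker_def)
  ultimately show ?thesis
    using z by simp
qed

end

theorem corollary1:
  fixes \<A> :: "('o, 'm, 'e) catdata_scheme"
    and f g f' g' a b c :: 'm
  defines "S \<equiv> \<lparr>sq_top = f, sq_left = a, sq_bottom = f', sq_right = b\<rparr>"
    and "T \<equiv> \<lparr>sq_top = g, sq_left = b, sq_bottom = g', sq_right = c\<rparr>"
  assumes "quasi_abelian_category \<A>"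
    and "commutative_square \<A> S" and "commutative_square \<A> T"
    and "is_exact \<A> f g" and "is_exact \<A> f' g'"
    and "is_strict \<A> b"
  shows "zeta \<A> S T \<in> Hom \<A> (sq_Ker \<A> T) (sq_Im \<A> S) \<and> is_isomorphism \<A> (zeta \<A> S T)"
proof -
  interpret quasi_abelian_category \<A>
    by fact
  interpret E: exact_rows_diagram \<A> "Dom \<A> f" "Dom \<A> g" "Cod \<A> g" "Dom \<A> f'" "Dom \<A> g'" "Cod \<A> g'"
    f g f' g' a b c
    using assms(3-7) unfolding S_def T_def
    by unfold_locales (auto simp: commutative_square_def is_exact_def Hom_def)
  show ?thesis
    using E.zeta_iso[OF assms(8)] by (simp add: S_def T_def E.S_def E.T_def)
qed

end
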